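(* Consider an instance of the multi-scenario dock assignment and truck scheduling problem with resource allocation. Fix a period $t\in\mathcal T$ and let $\Pi=\{j\in\mathcal J : r_j+\delta_j<t\le d_j\}$ be the set of trucks for which $t$ belongs to the feasible time window. Fix a resource type $r\in\{p,e,v\}$, and choose one scenario $s(j)\in\mathcal S^j$ for each $j\in\Pi$ such that the simultaneous use of the chosen scenarios violates the capacity of resource $r$, i.e. $\sum_{j\in\Pi} n_r(j,s(j))>R^r$, where $n_r(j,s)$ is the amount of resource $r$ required to serve truck $j$ under scenario $s$. Then every feasible solution satisfies $$\sum_{j\in\Pi} y_{jt}^{s(j)}\le |\Pi|-1 .$$
   Context: Instance data. $\mathcal J=\{1,\dots,N\}$ is a finite set of trucks, $\mathcal D$ a finite set of docks, $\mathcal T=\{0,1,\dots,T\}$ the discrete planning horizon. Each truck $j$ has an arrival time $r_j\in\mathcal T$, a strict latest departure time $d_j\in\mathcal T$, a docking (setup) time $\delta_j\in\mathbb Z_{\ge0}$, and a finite set $\mathcal S^j$ of resource deployment scenarios. Scenario $s\in\mathcal S^j$ is a quadruple $(w_j^s,e_j^s,v_j^s,p_j^s)$ of nonnegative integers: the numbers of workers, items of equipment and vehicles required to serve $j$, and the processing time. Write $n_p(j,s)=w_j^s$, $n_e(j,s)=e_j^s$, $n_v(j,s)=v_j^s$. The capacities of the three resource types are $R^p,R^e,R^v\ge 0$. Feasible solution. A feasible solution selects a set of served trucks (the others are unserved) and, for each served truck $j$, exactly one dock, exactly one scenario $s\in\mathcal S^j$ and a start period $t_j\in\mathcal T$, such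 that: $t_j\ge r_j$ and $t_j+\delta_j+p_j^s\le d_j$; if $k$ is served immediately after $j$ on the same dock then $t_k\ge t_j+\delta_j+p_j^s$; truck $j$ is being processed (and occupies the resources of its scenario) exactly in the periods $t_j+\delta_j+1,\dots,t_j+\delta_j+p_j^s$; and in each period $t\in\mathcal T$, for each resource type, the total amount required by the trucks being processed in period $t$ does not exceed the capacity. Variable. $y_{jt}^s\in\{0,1\}$ equals $1$ if and only if truck $j$ is being processed in period $t$ under scenario $s\in\mathcal S^j$. In terms of these variables the capacity conditions read $\sum_{j\in\mathcal J:\, r_j+\delta_j<t\le d_j}\sum_{s\in\mathcal S^j} n_r(j,s)\,y_{jt}^s\le R^r$ for all $t\in\mathcal T$ and $r\in\{p,e,v\}$. *)

theory Defs
  imports Complex_Main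
begin

datatype resource = Workers | Equipment | Vehicles

record scenario =
  workers :: nat
  equipment :: nat
  vehicles :: nat
  proc_time :: nat

text \<open>The amount $n_r(j,s)$. A scenario of truck \<open>j\<close> is itself the quadruple
  $(w_j^s, e_j^s, v_j^s, p_j^s)$, so the truck is not a separate argument.\<close>

fun demand :: "resource \<Rightarrow> scenario \<Rightarrow> nat" where
  "demand Workers s = workers s"
| "demand Equipment s = equipment s"
| "demand Vehicles s = vehicles s"

record 'd dock_problem =
  num_trucks :: nat
  docks :: "'d set"
  horizon :: nat
  arrival :: "nat \<Rightarrow> nat"
  departure :: "nat \<Rightarrow> nat"
  setup_time :: "nat \<Rightarrow> nat"
  scenarios :: "nat \<Rightarrow> scenario set"
  capacity :: "resource \<Rightarrow> real"

definition trucks :: "'d dock_problem \<Rightarrow> nat set" where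
  "trucks I = {1..num_trucks I}"

definition periods :: "'d dock_problem \<Rightarrow> nat set" where
  "periods I = {0..horizon I}"

definition valid_problem :: "'d dock_problem \<Rightarrow> bool" where
  "valid_problem I \<longleftrightarrow>
     finite (docks I) \<and>
     (\<forall>j\<in>trucks I. arrival I j \<in> periods I \<and> departure I j \<in> periods I \<and>
        finite (scenarios I j)) \<and>
     (\<forall>r. 0 \<le> capacity I r)"

text \<open>The functions of a solution are meaningful only on the served trucks; their values
  elsewhere are never used.\<close>

record 'd solution =
  served :: "nat set"
  dock_of :: "nat \<Rightarrow> 'd"
  scenario_of :: "nat \<Rightarrow> scenario"
  start_of :: "nat \<Rightarrow> nat"

definition completion :: "'d dock_problem \<Rightarrow> 'd solution \<Rightarrow> nat \<Rightarrow> nat" where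
  "completion I x j = start_of x j + setup_time I j + proc_time (scenario_of x j)"

definition processed_in :: "'d dock_problem \<Rightarrow> 'd solution \<Rightarrow> nat \<Rightarrow> nat \<Rightarrow> bool" where
  "processed_in I x j t \<longleftrightarrow>
     j \<in> served x \<and> t \<in> {start_of x j + setup_time I j + 1..completion I x j}"

text \<open>The list \<open>js\<close> is the order in which the trucks assigned to dock \<open>d\<close> are served there. The
  order is not read off from the start periods, since these could be tied.\<close>

definition dock_sequence :: "'d solution \<Rightarrow> 'd \<Rightarrow> nat list \<Rightarrow> bool" where
  "dock_sequence x d js \<longleftrightarrow> distinct js \<and> set js = {j \<in> served x. dock_of x j = d}"

definition feasible :: "'d dock_problem \<Rightarrow> 'd solution \<Rightarrow> bool" where
  "feasible I x \<longleftrightarrow>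
     served x \<subseteq> trucks I \<and>
     (\<forall>j\<in>served x.
        dock_of x j \<in> docks I \<and> scenario_of x j \<in> scenarios I j \<and> start_of x j \<in> periods I \<and>
        arrival I j \<le> start_of x j \<and> completion I x j \<le> departure I j) \<and>
     (\<forall>d\<in>docks I. \<exists>js. dock_sequence x d js \<and>
        (\<forall>i. Suc i < length js \<longrightarrow> completion I x (js ! i) \<le> start_of x (js ! Suc i))) \<and>
     (\<forall>t\<in>periods I. \<forall>r.
        real (\<Sum>j | processed_in I x j t. demand r (scenario_of x j)) \<le> capacity I r)"

text \<open>The variable $y_{jt}^s$ as determined by a solution.\<close>

definition y_var :: "'d dock_problem \<Rightarrow> 'd solution \<Rightarrow> nat \<Rightarrow> nat \<Rightarrow> scenario \<Rightarrow> int" where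
  "y_var I x j t s = (if processed_in I x j t \<and> scenario_of x j = s then 1 else 0)"

definition window_trucks :: "'d dock_problem \<Rightarrow> nat \<Rightarrow> nat set" where
  "window_trucks I t = {j \<in> trucks I. arrival I j + setup_time I j < t \<and> t \<le> departure I j}"

end

theory Submission
  imports Defs
begin

text \<open>This is a cover inequality. If its left-hand side were \<open>|\<Pi>|\<close>, then every truck of \<open>\<Pi>\<close> would
  be in process in period \<open>t\<close> under its chosen scenario. These trucks are among those that
  consume the resource in period \<open>t\<close>, so the consumption would be at least the sum of the chosen
  demands, which exceeds the capacity. Hence at least one of the binary variables vanishes.\<close>

theorem mainTheorem1:
  fixes I :: "'d dock_problem" and t :: nat and r :: resource
    and s :: "nat \<Rightarrow> scenario" and x :: "'d solution"
  assumes "valid_problem I"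
    and "t \<in> periods I"
    and "\<And>j. j \<in> window_trucks I t \<Longrightarrow> s j \<in> scenarios I j"
    and "real (\<Sum>j\<in>window_trucks I t. demand r (s j)) > capacity I r"
    and "feasible I x"
  shows "(\<Sum>j\<in>window_trucks I t. y_var I x j t (s j)) \<le> int (card (window_trucks I t)) - 1"
proof -
  let ?W = "window_trucks I t" and ?P = "{j. processed_in I x j t}"
  have fin_W: "finite ?W"
    by (simp add: window_trucks_def trucks_def)
  have "?P \<subseteq> trucks I"
    using assms(5) by (auto simp: feasible_def processed_in_def)
  then have fin_P: "finite ?P"
    by (rule finite_subset) (simp add: trucks_def)
  have cap: "real (\<Sum>j\<in>?P. demand r (scenario_of x j)) \<le> capacity I r"
    using assms(2,5) unfolding feasible_def by blast
  have "\<exists>j\<in>?W. y_var I x j t (s j) = 0"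
  proof (rule ccontr)
    assume "\<not> ?thesis"
    then have all: "processed_in I x j t \<and> scenario_of x j = s j" if "j \<in> ?W" for j
      using that by (auto simp: y_var_def split: if_splits)
    have "(\<Sum>j\<in>?W. demand r (s j)) = (\<Sum>j\<in>?W. demand r (scenario_of x j))"
      using all by (intro sum.cong) auto
    also have "\<dots> \<le> (\<Sum>j\<in>?P. demand r (scenario_of x j))"
      using fin_P all by (intro sum_mono2) auto
    finally show False
      using cap assms(4) by linarith
  qed
  then obtain k where k: "k \<in> ?W" "y_var I x k t (s k) = 0"
    by blast
  have "(\<Sum>j\<in>?W. y_var I x j t (s j)) = (\<Sum>j\<in>?W - {k}. y_var I x j t (s j))"
    using k fin_W by (simp add: sum.remove)
  also have "\<dots> \<le> (\<Sum>j\<in>?W - {k}. 1)"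
    by (intro sum_mono) (simp add: y_var_def)
  also have "\<dots> = int (card ?W) - 1"
    using card_Suc_Diff1[OF fin_W k(1)] by simp
  finally show ?thesis .
qed

end
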